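(* For every integer $k \geq 3$ there are infinitely many positive integers $n$ such that the map $pre_k$, restricted to the set of partitions of $n$ having exactly $k$ parts, is not injective. In particular, the statement "for every $k\ge 3$ and every $n$, $pre_k$ is injective on the set of partitions of $n$ with at least $k$ parts" is false.
   Context: A partition $\lambda=(\lambda_1,\dots,\lambda_\ell)$ of $n$ is a non-increasing sequence of positive integers summing to $n$; $\ell$ is its number of parts. For $k\ge 1$, $pre_k(\lambda)$ is the partition whose multiset of parts is $\{\lambda_{i_1}\lambda_{i_2}\cdots\lambda_{i_k} : 1\le i_1<i_2<\cdots<i_k\le \ell\}$ if $\ell\ge k$, and is the empty partition if $\ell<k$. (E.g. $pre_2(7,4,4)=(28,28,16)$.) *)

theory Defs
  imports Main "HOL-Library.Multiset"
begin

definition partitions :: "nat \<Rightarrow> nat list set" where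
  "partitions n = {xs. sorted_wrt (\<ge>) xs \<and> (\<forall>x\<in>set xs. 0 < x) \<and> sum_list xs = n}"

(* A choice of indices i_1 < ... < i_k is encoded as the k-element set of (0-based) positions.
   The image over mset_set keeps multiplicities: different index sets giving equal products
   contribute separate parts.  If length xs < k there is no such index set and the multiset
   is empty. *)
definition pre_parts :: "nat \<Rightarrow> nat list \<Rightarrow> nat multiset" where
  "pre_parts k xs =
     image_mset (\<lambda>I. \<Prod>i\<in>I. xs ! i) (mset_set {I. I \<subseteq> {..<length xs} \<and> card I = k})"

definition pre :: "nat \<Rightarrow> nat list \<Rightarrow> nat list" where
  "pre k xs = rev (sorted_list_of_multiset (pre_parts k xs))"

end

(* A partition with exactly k parts is mapped by pre_k to the product of its parts, so it is enough
   to find two k-part partitions with equal sum and equal product. The triples (6,6,1) and (9,2,2)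
   both have sum 13 and product 36; scaling them by m and appending k - 3 ones gives a collision
   for n = 13 m + k - 3, for every m > 0. *)
theory Submission
  imports Defs
begin

text \<open>The full index set is the only subset of the positions with \<open>length xs\<close>
  elements, so exactly one product is formed.\<close>

lemma pre_parts_length: "pre_parts (length xs) xs = {#prod_list xs#}"
proof -
  have "{I. I \<subseteq> {..<length xs} \<and> card I = length xs} = {{..<length xs}}"
    using card_subset_eq[of "{..<length xs}"] by auto
  then show ?thesis
    by (simp add: pre_parts_def prod.list_conv_set_nth atLeast0LessThan)
qed

lemma pre_not_inj_on:
  assumes "k \<ge> 3" "m > 0"
  shows "\<not> inj_on (pre k) {xs \<in> partitions (13 * m + (k - 3)). length xs = k}"
proof
  assume inj: "inj_on (pre k) {xs \<in> partitions (13 * m + (k - 3)). length xs = k}"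
  define xs where "xs = [6 * m, 6 * m, m] @ replicate (k - 3) 1"
  define ys where "ys = [9 * m, 2 * m, 2 * m] @ replicate (k - 3) 1"
  have len: "length xs = k" "length ys = k"
    using assms by (simp_all add: xs_def ys_def)
  have "prod_list xs = prod_list ys"
    by (simp add: xs_def ys_def)
  then have "pre k xs = pre k ys"
    using pre_parts_length[of xs] pre_parts_length[of ys] len by (simp add: pre_def)
  \<comment> \<open>Since \<open>m > 0\<close>, all parts are positive and the last scaled part is
    at least 1, so the appended ones keep the lists non-increasing. The index form of sortedness
    settles the block of ones.\<close>
  moreover have "xs \<in> partitions (13 * m + (k - 3))" "ys \<in> partitions (13 * m + (k - 3))"
    using assms
    by (auto simp: xs_def ys_def partitions_def sum_list_replicate
        intro: sorted_wrt_iff_nth_less[THEN iffD2])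
  ultimately have "xs = ys"
    using inj len by (auto dest: inj_onD)
  \<comment> \<open>The heads \<open>6 * m\<close> and \<open>9 * m\<close> differ because
    \<open>m > 0\<close>.\<close>
  then show False
    using assms by (simp add: xs_def ys_def)
qed

theorem theorem1p3:
  shows "(\<forall>k::nat. k \<ge> 3 \<longrightarrow>
            infinite {n::nat. 0 < n \<and> \<not> inj_on (pre k) {xs \<in> partitions n. length xs = k}})
       \<and> \<not> (\<forall>k::nat. k \<ge> 3 \<longrightarrow>
            (\<forall>n::nat. 0 < n \<longrightarrow> inj_on (pre k) {xs \<in> partitions n. length xs \<ge> k}))"
proof (intro conjI allI impI)
  fix k :: nat
  assume k: "k \<ge> 3"
  \<comment> \<open>Using \<open>Suc m\<close> keeps the scaling factor positive; distinct factors
    give distinct sums, hence infinitely many \<open>n\<close>.\<close>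
  have "inj (\<lambda>m. 13 * Suc m + (k - 3))"
    by (simp add: inj_on_def)
  then have "infinite (range (\<lambda>m. 13 * Suc m + (k - 3)))"
    using finite_imageD by blast
  moreover have "range (\<lambda>m. 13 * Suc m + (k - 3)) \<subseteq>
      {n. 0 < n \<and> \<not> inj_on (pre k) {xs \<in> partitions n. length xs = k}}"
  proof (intro subsetI, elim rangeE)
    fix n m
    assume "n = 13 * Suc m + (k - 3)"
    then show "n \<in> {n. 0 < n \<and> \<not> inj_on (pre k) {xs \<in> partitions n. length xs = k}}"
      using pre_not_inj_on[OF k, of "Suc m"] by simp
  qed
  ultimately show "infinite {n. 0 < n \<and> \<not> inj_on (pre k) {xs \<in> partitions n. length xs = k}}"
    using finite_subset by blast
next
  have "\<not> inj_on (pre 3) {xs \<in> partitions 13. length xs = 3}"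
    using pre_not_inj_on[of 3 1] by simp
  \<comment> \<open>Injectivity passes to subsets, so a collision among partitions with exactly 3
    parts persists when more parts are allowed.\<close>
  then have "\<not> inj_on (pre 3) {xs \<in> partitions 13. length xs \<ge> 3}"
    by (rule contrapos_nn) (auto elim: inj_on_subset)
  then show "\<not> (\<forall>k::nat. k \<ge> 3 \<longrightarrow>
      (\<forall>n::nat. 0 < n \<longrightarrow> inj_on (pre k) {xs \<in> partitions n. length xs \<ge> k}))"
    by (metis order_refl zero_less_numeral)
qed

end
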